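(* Let $\lambda\in(0,1)$, let $\tau_0(x)=\lambda x$, $\tau_{1/4}(x)=\lambda(x+\frac14)$, let $X_L$ be their attractor, let $W(x)=\cos^2(2\pi x/\lambda)$, and let $h_0,h_1$ be the functions on $X_L$ described in the context. (i) If $\lambda\notin\{1-\frac1{2n}:n\in\mathbb{N}\}$, then $h_0(x)=1$ for all $x\in X_L$. (ii) If $\lambda=1-\frac1{2n}$ for some $n\in\mathbb{N}$, then $h_0(x)+h_1(x)=1$ for all $x\in X_L$.
   Context: $X_L$ is the unique nonempty compact set with $X_L=\tau_0(X_L)\cup\tau_{1/4}(X_L)$. Let $\Omega=\{0,\frac14\}^{\mathbb{N}}$ with the $\sigma$-algebra generated by cylinder sets. For $x\in X_L$, $P_x$ is the unique probability measure on $\Omega$ such that for every $n$ and $\omega_1,\dots,\omega_n\in\{0,\frac14\}$, the cylinder $\{\eta:\eta_i=\omega_i,\ i\le n\}$ has measure $W(\tau_{\omega_1}x)W(\tau_{\omega_2}\tau_{\omega_1}x)\cdots W(\tau_{\omega_n}\cdots\tau_{\omega_1}x)$ (this is consistent since $W(\tau_0y)+W(\tau_{1/4}y)=1$). $\mathbf{N}_0$ is the set of $\omega\in\Omega$ with $\omega_n=0$ for all large $n$, $\mathbf{N}_1$ the set of $\omega$ with $\omega_n=\frac14$ for all large $n$; $h_0(x)=P_x(\mathbf{N}_0)$ and $h_1(x)=P_x(\mathbf{N}_1)$. *)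

theory Defs
  imports "HOL-Probability.Probability"
begin

definition tau :: "real \<Rightarrow> real \<Rightarrow> real \<Rightarrow> real" where
  "tau lam a x = lam * (x + a)"

definition XL :: "real \<Rightarrow> real set" where
  "XL lam = (THE K. compact K \<and> K \<noteq> {} \<and>
              K = tau lam 0 ` K \<union> tau lam (1/4) ` K)"

definition W :: "real \<Rightarrow> real \<Rightarrow> real" where
  "W lam x = (cos (2 * pi * x / lam))\<^sup>2"

text \<open>Omega = {0,1/4}^N with the product sigma-algebra (generated by cylinder sets).
  Sequences are indexed from 0: omega 0 plays the role of omega_1.\<close>
definition Omega :: "(nat \<Rightarrow> real) measure" where
  "Omega = PiM UNIV (\<lambda>_. count_space {0, 1/4})"

fun orb :: "real \<Rightarrow> real \<Rightarrow> (nat \<Rightarrow> real) \<Rightarrow> nat \<Rightarrow> real" where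
  "orb lam x \<omega> 0 = x"
| "orb lam x \<omega> (Suc k) = tau lam (\<omega> k) (orb lam x \<omega> k)"

definition cyl :: "nat \<Rightarrow> (nat \<Rightarrow> real) \<Rightarrow> (nat \<Rightarrow> real) set" where
  "cyl n \<omega> = {\<eta> \<in> space Omega. \<forall>i<n. \<eta> i = \<omega> i}"

definition Px :: "real \<Rightarrow> real \<Rightarrow> (nat \<Rightarrow> real) measure" where
  "Px lam x = (THE M. sets M = sets Omega \<and> prob_space M \<and>
      (\<forall>n \<omega>. (\<forall>i<n. \<omega> i \<in> {0, 1/4}) \<longrightarrow>
         emeasure M (cyl n \<omega>) = ennreal (\<Prod>i<n. W lam (orb lam x \<omega> (Suc i)))))"

definition N0 :: "(nat \<Rightarrow> real) set" where
  "N0 = {\<omega> \<in> space Omega. \<exists>N. \<forall>n\<ge>N. \<omega> n = 0}"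

definition N1 :: "(nat \<Rightarrow> real) set" where
  "N1 = {\<omega> \<in> space Omega. \<exists>N. \<forall>n\<ge>N. \<omega> n = 1/4}"

definition h0 :: "real \<Rightarrow> real \<Rightarrow> real" where
  "h0 lam x = measure (Px lam x) N0"

definition h1 :: "real \<Rightarrow> real \<Rightarrow> real" where
  "h1 lam x = measure (Px lam x) N1"

end

theory Submission
  imports Defs
begin

text \<open>The exit probability \<open>h\<close> is harmonic for the walk that moves from \<open>z\<close> to \<open>\<lambda>z\<close> with
  probability \<open>cos\<^sup>2(2\<pi>z)\<close> and to \<open>\<lambda>(z + 1/4)\<close> with probability \<open>sin\<^sup>2(2\<pi>z)\<close>, and it tends to 1
  at the fixed points where the walk is absorbed, namely 0 and possibly
  \<open>\<lambda>/(4(1 - \<lambda>))\<close>, the fixed point of \<open>\<tau>\<^bsub>1/4\<^esub>\<close>.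
  By harmonicity, the limit points of minimizing sequences of \<open>h\<close> on an invariant interval are
  closed under the possible moves. Hence \<open>h = 1\<close> as soon as every point can reach points
  arbitrarily close to an absorbing one.

  The only obstruction to descending to 0 is meeting an odd multiple of 1/4, where the move is
  forced. If every reachable point descends to such an \<open>m/4\<close>, take \<open>|m|\<close> minimal. Unless
  \<open>m/4\<close> is the fixed point of \<open>\<tau>\<^bsub>1/4\<^esub>\<close>, the points reached from \<open>m/4\<close> by \<open>\<lambda>(\<cdot> + 1/4)\<close> and
  a few further moves all have to lie on the same orbit \<open>\<lambda>\<^sup>-\<^sup>im/4\<close>, which is
  impossible.\<close>

subsection \<open>Reachability of an absorbing point\<close>

text \<open>Coordinates are scaled by 4: the move to \<open>lam * z\<close> is impossible exactly at
  odd integers, the move to \<open>lam * (z + 1)\<close> exactly at even ones. \<open>P\<close> is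
  any nonempty set closed under the possible moves.\<close>

lemma escape_int:
  fixes lam x :: real and P :: "real \<Rightarrow> bool"
  assumes lam: "0 < lam" "lam < 1" and "P x"
    and P0: "\<And>z. P z \<Longrightarrow> \<nexists>k. odd k \<and> z = of_int k \<Longrightarrow> P (lam * z)"
    and P1: "\<And>z. P z \<Longrightarrow> \<nexists>k. even k \<and> z = of_int k \<Longrightarrow> P (lam * (z + 1))"
  shows "\<exists>z. P z \<and> ((\<forall>i. \<nexists>k. odd k \<and> lam ^ i * z = of_int k) \<or>
                     (\<exists>k. odd k \<and> z = of_int k \<and> lam * (z + 1) = z))"
proof (rule ccontr)
  assume neg: "\<not> ?thesis"
  \<comment> \<open>Before its first odd value, the descent from \<open>z\<close> consists of possible moves.\<close>
  have hit: "\<exists>i k. odd k \<and> lam ^ i * z = of_int k \<and> (\<forall>l\<le>i. P (lam ^ l * z))" if "P z" for z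
  proof -
    define i where "i = (LEAST i. \<exists>k. odd k \<and> lam ^ i * z = of_int k)"
    have ex: "\<exists>i k. odd k \<and> lam ^ i * z = of_int k"
      using neg that by blast
    have "\<exists>k. odd k \<and> lam ^ i * z = of_int k"
      unfolding i_def by (rule LeastI_ex[OF ex])
    moreover have "P (lam ^ l * z)" if "l \<le> i" for l
      using that
    proof (induction l)
      case (Suc l)
      then have "l < i" by simp
      then have "\<nexists>k. odd k \<and> lam ^ l * z = of_int k"
        using not_less_Least[of l "\<lambda>i. \<exists>k. odd k \<and> lam ^ i * z = of_int k"]
        unfolding i_def by blast
      from P0[OF Suc.IH this] show ?case using Suc.prems by (simp add: mult.assoc)
    qed (use \<open>P z\<close> in simp)
    ultimately show ?thesis by blast
  qed
  have "\<exists>m::int. (odd m \<and> P (of_int m)) \<and> (\<forall>k. odd k \<and> P (of_int k) \<longrightarrow> nat \<bar>m\<bar> \<le> nat \<bar>k\<bar>)"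
  proof -
    obtain k where "odd k \<and> P (of_int k)" using hit[OF \<open>P x\<close>] by force
    from ex_has_least_nat[of "\<lambda>k. odd k \<and> P (of_int k)", OF this, of "\<lambda>k. nat \<bar>k\<bar>"]
    show ?thesis by blast
  qed
  then obtain m :: int where m: "odd m" "P (of_int m)"
    and least: "\<And>k. odd k \<Longrightarrow> P (of_int k) \<Longrightarrow> \<bar>m\<bar> \<le> \<bar>k\<bar>"
    by (metis abs_ge_zero nat_le_eq_zle abs_of_nonneg)
  have pow: "0 < lam ^ i" "lam ^ i \<le> 1" for i
    using lam by (simp_all add: power_le_one)
  \<comment> \<open>The bound \<open>m + 2\<close> leaves no choice: since \<open>m\<close> has
    least modulus, the only odd integer the descent can meet between 0 and \<open>m + 2\<close> is
    \<open>m\<close>.\<close>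
  have hit_below: "\<exists>i. lam ^ i * z = of_int m \<and> (\<forall>l\<le>i. P (lam ^ l * z))"
    if "P z" "0 < z" "z < of_int m + 2" for z
  proof -
    obtain i k where k: "odd k" "lam ^ i * z = of_int k" "\<forall>l\<le>i. P (lam ^ l * z)"
      using hit[OF \<open>P z\<close>] by blast
    have "lam ^ i * z \<le> z" "0 < lam ^ i * z"
      using pow[of i] that(2) by (simp_all add: mult_left_le_one_le)
    then have "real_of_int k < of_int (m + 2)" "0 < real_of_int k" using k that by simp_all
    then have "k < m + 2" "0 < k" by linarith+
    moreover have "\<bar>m\<bar> \<le> \<bar>k\<bar>" using least[of k] k by auto
    moreover have "k \<noteq> m + 1" using k(1) m(1) by auto
    ultimately have "k = m \<or> k = - m" by linarith
    with \<open>k < m + 2\<close> \<open>0 < k\<close> have "k = m" by linarith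
    with k show ?thesis by auto
  qed
  define b where "b = lam * (of_int m + 1)"
  have "P b" unfolding b_def
    by (rule P1[OF m(2)]) (use m(1) in auto)
  have "b \<noteq> of_int m"
    using neg m unfolding b_def by auto
  \<comment> \<open>For negative \<open>m\<close> the factor \<open>lam\<close> does not lower
    \<open>m + 1\<close>. For positive \<open>m\<close>, a smaller \<open>b\<close> would descend to
    an odd integer strictly between 0 and \<open>m\<close>, against minimality.\<close>
  have "of_int m < b"
  proof (rule ccontr)
    assume "\<not> of_int m < b"
    then have lt: "b < of_int m" using \<open>b \<noteq> of_int m\<close> by simp
    obtain i k where k: "odd k" "lam ^ i * b = of_int k" "P (of_int k)"
      using hit[OF \<open>P b\<close>] by force
    have "m \<noteq> 0" using m(1) by auto
    moreover have "\<not> m < 0"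
    proof
      assume "m < 0"
      then have "real_of_int m + 1 \<le> 0" by linarith
      then have "lam * (of_int m + 1) \<ge> 1 * (real_of_int m + 1)"
        using lam by (intro mult_right_mono_neg) auto
      then show False using lt unfolding b_def by simp
    qed
    ultimately have "m > 0" by linarith
    then have "0 < b" using lam unfolding b_def by simp
    have "lam ^ i * b \<le> b" "0 < lam ^ i * b"
      using pow[of i] \<open>0 < b\<close> by (simp_all add: mult_left_le_one_le)
    then have "0 < real_of_int k" "real_of_int k < of_int m" using k lt by simp_all
    then show False using least[OF k(1) k(3)] by simp
  qed
  \<comment> \<open>If \<open>m\<close> were negative, then \<open>m < b \<le> 0\<close>, and the
    descent from \<open>b\<close> would meet an odd integer nearer to 0 than
    \<open>m\<close>.\<close>
  have "m > 0"
  proof (rule ccontr)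
    assume "\<not> 0 < m"
    then have "real_of_int m + 1 \<le> 0 \<or> m = 0" by linarith
    moreover have "m \<noteq> 0" using m(1) by auto
    ultimately have le: "real_of_int m + 1 \<le> 0" by simp
    obtain i k where k: "odd k" "lam ^ i * b = of_int k" "P (of_int k)"
      using hit[OF \<open>P b\<close>] by force
    have "b \<le> 0" using le lam unfolding b_def by (simp add: mult_nonneg_nonpos)
    then have "b \<le> lam ^ i * b" "lam ^ i * b \<le> 0"
      using pow[of i] mult_right_mono_neg[of "lam ^ i" 1 b]
      by (simp_all add: mult_nonneg_nonpos)
    then have "of_int m < real_of_int k" "real_of_int k \<le> 0" using k \<open>of_int m < b\<close> by simp_all
    then show False using least[OF k(1) k(3)] by simp
  qed
  then have m1: "real_of_int m \<ge> 1" by simp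
  have b_less: "b < of_int m + 1"
    using lam m1 unfolding b_def by simp
  obtain i where i: "lam ^ i * b = of_int m" "\<forall>l\<le>i. P (lam ^ l * b)"
    using hit_below[OF \<open>P b\<close>] \<open>of_int m < b\<close> b_less m1 by force
  then obtain j where j: "i = Suc j" using \<open>b \<noteq> of_int m\<close> by (cases i) auto
  \<comment> \<open>The last point before \<open>m\<close> on the descent from \<open>b\<close>. It
    lies strictly between \<open>m\<close> and \<open>m + 1\<close>, so it is no integer and the
    move to \<open>lam * (y + 1)\<close> is open.\<close>
  define y where "y = lam ^ j * b"
  have "P y" using i(2) j unfolding y_def by simp
  have lamy: "lam * y = of_int m" using i(1) j unfolding y_def by (simp add: mult.assoc)
  have "y \<le> b" unfolding y_def using pow[of j] \<open>of_int m < b\<close> m1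
    by (intro mult_left_le_one_le) auto
  have "y > of_int m"
  proof -
    have "y > 0" unfolding y_def using pow[of j] \<open>of_int m < b\<close> m1 by simp
    then have "lam * y < y" using lam by simp
    then show ?thesis using lamy by simp
  qed
  have "\<nexists>k. even k \<and> y = of_int k"
  proof
    assume "\<exists>k. even k \<and> y = of_int k"
    then obtain k :: int where "y = of_int k" by blast
    then have "m < k" "k < m + 1" using \<open>y > of_int m\<close> \<open>y \<le> b\<close> b_less by linarith+
    then show False by simp
  qed
  from P1[OF \<open>P y\<close> this] have "P (lam * (y + 1))" .
  moreover have "lam * (y + 1) < y + 1" "0 < lam * (y + 1)"
    using lam \<open>y > of_int m\<close> m1 by simp_all
  ultimately obtain k where k: "lam ^ k * (lam * (y + 1)) = of_int m"
    using hit_below[of "lam * (y + 1)"] \<open>y \<le> b\<close> b_less by force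
  have jm: "lam ^ Suc i * (of_int m + 1) = of_int m"
    using i(1) unfolding b_def by (simp add: algebra_simps)
  have y1: "y + 1 > of_int m + 1" using \<open>y > of_int m\<close> by simp
  \<comment> \<open>With \<open>\<mu> = 1/\<lambda>\<close>: \<open>y = \<mu>m\<close>, \<open>m + 1 = \<mu>\<^sup>i\<^sup>+\<^sup>1m\<close> and \<open>y + 1 = \<mu>\<^sup>k\<^sup>+\<^sup>1m\<close>. From \<open>y > m\<close> we get
    \<open>k > i\<close>, hence \<open>y + 1 \<ge> \<mu>(m + 1) = y + \<mu> > y + 1\<close>.\<close>
  show False
  proof (cases "k \<le> i")
    case True
    then have "lam ^ Suc i \<le> lam ^ Suc k" using lam by (intro power_decreasing) auto
    then have "lam ^ Suc i * (y + 1) \<le> lam ^ Suc k * (y + 1)"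
      using y1 m1 by (intro mult_right_mono) auto
    moreover have "lam ^ Suc i * (of_int m + 1) < lam ^ Suc i * (y + 1)"
      using y1 lam by (intro mult_strict_left_mono) auto
    ultimately show False using k jm by (simp add: algebra_simps)
  next
    case False
    then have "lam ^ Suc k \<le> lam ^ Suc (Suc i)" using lam by (intro power_decreasing) auto
    then have "lam ^ Suc k * (y + 1) \<le> lam ^ Suc (Suc i) * (y + 1)"
      using y1 m1 by (intro mult_right_mono) auto
    also have "\<dots> = lam ^ Suc i * (lam * y + lam)" by (simp add: algebra_simps)
    also have "\<dots> < lam ^ Suc i * (of_int m + 1)"
      unfolding lamy using lam by (intro mult_strict_left_mono) auto
    finally show False using k jm by (simp add: algebra_simps)
  qed
qed


section \<open>Zeros of cosine and sine, and the return to the original scale\<close>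

lemma cos_two_pi_eq_0_iff: "cos (2 * pi * z) = 0 \<longleftrightarrow> (\<exists>k::int. odd k \<and> 4 * z = of_int k)"
proof -
  have "2 * pi * z = of_int k * (pi / 2) \<longleftrightarrow> 4 * z = of_int k" for k :: int
    by (simp add: field_simps)
  then show ?thesis by (simp add: cos_zero_iff_int)
qed

lemma sin_two_pi_eq_0_iff: "sin (2 * pi * z) = 0 \<longleftrightarrow> (\<exists>k::int. even k \<and> 4 * z = of_int k)"
proof -
  have "2 * pi * z = of_int k * (pi / 2) \<longleftrightarrow> 4 * z = of_int k" for k :: int
    by (simp add: field_simps)
  then show ?thesis by (simp add: sin_zero_iff_int)
qed

text \<open>Multiplying by 4 turns the zeros of cosine and sine into odd and even integers, which
  reduces this to \<open>escape_int\<close>.\<close>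

lemma escape:
  fixes lam x :: real and P :: "real \<Rightarrow> bool"
  assumes lam: "0 < lam" "lam < 1" and "P x"
    and P0: "\<And>z. P z \<Longrightarrow> cos (2 * pi * z) \<noteq> 0 \<Longrightarrow> P (lam * z)"
    and P1: "\<And>z. P z \<Longrightarrow> sin (2 * pi * z) \<noteq> 0 \<Longrightarrow> P (lam * (z + 1/4))"
  shows "\<exists>z. P z \<and> ((\<forall>i. cos (2 * pi * (lam ^ i * z)) \<noteq> 0) \<or>
                     (cos (2 * pi * z) = 0 \<and> lam * (z + 1/4) = z))"
proof -
  have "\<exists>z. P (z / 4) \<and> ((\<forall>i. \<nexists>k. odd k \<and> lam ^ i * z = of_int k) \<or>
                     (\<exists>k. odd k \<and> z = of_int k \<and> lam * (z + 1) = z))"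
  proof (rule escape_int[OF lam, of "\<lambda>z. P (z / 4)" "4 * x"])
    show "P (lam * z / 4)" if "P (z / 4)" "\<nexists>k. odd k \<and> z = of_int k" for z
    proof -
      have "cos (2 * pi * (z / 4)) \<noteq> 0"
        using that(2) unfolding cos_two_pi_eq_0_iff by simp
      from P0[OF that(1) this] show ?thesis by simp
    qed
    show "P (lam * (z + 1) / 4)" if "P (z / 4)" "\<nexists>k. even k \<and> z = of_int k" for z
    proof -
      have "lam * (z + 1) / 4 = lam * (z / 4 + 1 / 4)" by (simp add: field_simps)
      moreover have "sin (2 * pi * (z / 4)) \<noteq> 0"
        using that(2) unfolding sin_two_pi_eq_0_iff by simp
      ultimately show ?thesis using P1[OF that(1)] by metis
    qed
  qed (use \<open>P x\<close> in simp)
  then obtain z where z: "P (z / 4)"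
    "(\<forall>i. \<nexists>k. odd k \<and> lam ^ i * z = of_int k) \<or> (\<exists>k. odd k \<and> z = of_int k \<and> lam * (z + 1) = z)"
    by blast
  then have "(\<forall>i. cos (2 * pi * (lam ^ i * (z / 4))) \<noteq> 0) \<or>
    (cos (2 * pi * (z / 4)) = 0 \<and> lam * (z / 4 + 1 / 4) = z / 4)"
    unfolding cos_two_pi_eq_0_iff by (auto simp: field_simps)
  with z(1) show ?thesis by blast
qed

subsection \<open>Bounded harmonic functions\<close>

text \<open>As \<open>h\<close> is not known to be continuous, a minimizer may fail to exist, so the
  argument runs with limits of minimizing sequences. The quadratic lower bounds survive such limits
  and carry the boundary value 1 into the conclusion.\<close>

lemma harmonic_eq_1:
  fixes lam x C :: real and h :: "real \<Rightarrow> real"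
  assumes lam: "0 < lam" "lam < 1"
    and h_nonneg: "\<And>z. 0 \<le> h z" and h_le_1: "\<And>z. h z \<le> 1"
    and harmonic: "\<And>z. h z = (cos (2 * pi * z))\<^sup>2 * h (lam * z)
                           + (sin (2 * pi * z))\<^sup>2 * h (lam * (z + 1/4))"
    and near_0: "\<And>z. 1 - C * z\<^sup>2 \<le> h z"
    and near_fix: "\<And>z. cos (2 * pi * z) = 0 \<Longrightarrow> lam * (z + 1/4) = z \<Longrightarrow>
                     \<exists>D. \<forall>y. 1 - D * (y - z)\<^sup>2 \<le> h y"
  shows "h x = 1"
proof -
  \<comment> \<open>\<open>lam / (4 * (1 - lam))\<close> is the fixed point of the second move; with
    \<open>R\<close> at least that large, both moves map \<open>S\<close> into itself.\<close>
  define R where "R = max \<bar>x\<bar> (lam / (4 * (1 - lam)))"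
  define S where "S = {-R..R}"
  define c where "c = Inf (h ` S)"
  have "x \<in> S" unfolding S_def R_def by (auto simp: abs_le_iff)
  have bdd: "bdd_below (h ` S)" using h_nonneg by (auto simp: bdd_below_def)
  have c_le: "c \<le> h y" if "y \<in> S" for y
    unfolding c_def by (rule cInf_lower) (use that bdd in auto)
  have "0 \<le> R" unfolding R_def by auto
  have "lam / (4 * (1 - lam)) \<le> R" unfolding R_def by simp
  then have Rle: "lam * (R + 1/4) \<le> R" using lam by (simp add: field_simps)
  have S0: "lam * y \<in> S" if "y \<in> S" for y
  proof -
    have "\<bar>lam * y\<bar> \<le> 1 * R" unfolding abs_mult using that lam \<open>0 \<le> R\<close>
      by (intro mult_mono) (auto simp: S_def)
    then show ?thesis by (auto simp: S_def abs_le_iff)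
  qed
  have S1: "lam * (y + 1/4) \<in> S" if "y \<in> S" for y
  proof -
    have "\<bar>lam * (y + 1/4)\<bar> \<le> lam * (R + 1/4)" unfolding abs_mult using that lam
      by (intro mult_mono) (auto simp: S_def)
    then show ?thesis using Rle by (auto simp: S_def abs_le_iff)
  qed
  \<comment> \<open>Only the values along the sequence tend to \<open>c\<close>;
    \<open>h z = c\<close> is not claimed.\<close>
  define P where "P z \<longleftrightarrow> (\<exists>s. (\<forall>n. s n \<in> S) \<and> s \<longlonglongrightarrow> z \<and> (\<lambda>n. h (s n)) \<longlonglongrightarrow> c)" for z
  \<comment> \<open>Near \<open>z\<close> the weight \<open>w\<close> stays away from 0, so
    \<open>ineq\<close> forces the images under \<open>T\<close> of a minimizing sequence to be
    minimizing as well.\<close>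
  have step: "P (T z)"
    if "P z" and w: "isCont w z" "w z > 0" and T: "isCont T z" "\<And>y. y \<in> S \<Longrightarrow> T y \<in> S"
      and ineq: "\<And>y. y \<in> S \<Longrightarrow> w y * (h (T y) - c) \<le> h y - c" for z w T
  proof -
    obtain s where s: "\<And>n. s n \<in> S" "s \<longlonglongrightarrow> z" "(\<lambda>n. h (s n)) \<longlonglongrightarrow> c"
      using \<open>P z\<close> unfolding P_def by blast
    have ws: "(\<lambda>n. w (s n)) \<longlonglongrightarrow> w z" using w(1) s(2) by (rule isCont_tendsto_compose)
    have pos: "eventually (\<lambda>n. 0 < w (s n)) sequentially"
      using order_tendstoD(1)[OF ws w(2)] .
    have "(\<lambda>n. h (T (s n)) - c) \<longlonglongrightarrow> 0"
    proof (rule tendsto_sandwich)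
      show "eventually (\<lambda>n. 0 \<le> h (T (s n)) - c) sequentially"
        using c_le s(1) T(2) by auto
      show "eventually (\<lambda>n. h (T (s n)) - c \<le> (h (s n) - c) / w (s n)) sequentially"
        using pos by eventually_elim (use ineq s(1) in \<open>auto simp: field_simps\<close>)
      have "(\<lambda>n. (h (s n) - c) / w (s n)) \<longlonglongrightarrow> (c - c) / w z"
        using s(3) ws w(2) by (intro tendsto_intros) auto
      then show "(\<lambda>n. (h (s n) - c) / w (s n)) \<longlonglongrightarrow> 0" by simp
    qed simp
    then have "(\<lambda>n. h (T (s n))) \<longlonglongrightarrow> c" by (simp add: LIM_zero_iff)
    moreover have "(\<lambda>n. T (s n)) \<longlonglongrightarrow> T z" using T(1) s(2) by (rule isCont_tendsto_compose)
    ultimately show ?thesis unfolding P_def using s(1) T(2) by (intro exI[of _ "\<lambda>n. T (s n)"]) auto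
  qed
  have P0: "P (lam * z)" if "P z" "cos (2 * pi * z) \<noteq> 0" for z
  proof (rule step[OF that(1), of "\<lambda>z. (cos (2 * pi * z))\<^sup>2"])
    fix y assume y: "y \<in> S"
    \<comment> \<open>Bounding the other branch below by \<open>c\<close>, with squared sine and
      cosine summing to 1, turns harmonicity into the inequality that \<open>step\<close> requires.
      \<open>P1\<close> is symmetric.\<close>
    have "(sin (2 * pi * y))\<^sup>2 * c \<le> (sin (2 * pi * y))\<^sup>2 * h (lam * (y + 1/4))"
      using c_le[OF S1[OF y]] by (intro mult_left_mono) auto
    then show "(cos (2 * pi * y))\<^sup>2 * (h (lam * y) - c) \<le> h y - c"
      unfolding harmonic[of y] by (simp add: sin_squared_eq algebra_simps)
  qed (use that S0 in auto)
  have P1: "P (lam * (z + 1/4))" if "P z" "sin (2 * pi * z) \<noteq> 0" for z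
  proof (rule step[OF that(1), of "\<lambda>z. (sin (2 * pi * z))\<^sup>2" "\<lambda>z. lam * (z + 1/4)"])
    fix y assume y: "y \<in> S"
    have "(cos (2 * pi * y))\<^sup>2 * c \<le> (cos (2 * pi * y))\<^sup>2 * h (lam * y)"
      using c_le[OF S0[OF y]] by (intro mult_left_mono) auto
    then show "(sin (2 * pi * y))\<^sup>2 * (h (lam * (y + 1/4)) - c) \<le> h y - c"
      unfolding harmonic[of y] by (simp add: sin_squared_eq algebra_simps)
  qed (use that S1 in auto)
  have P_bound: "1 - D * (z - t)\<^sup>2 \<le> c" if "P z" "\<And>y. 1 - D * (y - t)\<^sup>2 \<le> h y" for z t D
  proof -
    obtain s where s: "s \<longlonglongrightarrow> z" "(\<lambda>n. h (s n)) \<longlonglongrightarrow> c"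
      using \<open>P z\<close> unfolding P_def by blast
    have "(\<lambda>n. 1 - D * (s n - t)\<^sup>2) \<longlonglongrightarrow> 1 - D * (z - t)\<^sup>2"
      by (intro tendsto_intros s)
    from this s(2) show ?thesis by (rule LIMSEQ_le) (use that(2) in auto)
  qed
  have "\<exists>x0. P x0"
  proof -
    have "\<exists>y\<in>S. h y < c + 1 / real (Suc n)" for n
    proof -
      have "Inf (h ` S) < c + 1 / real (Suc n)" unfolding c_def by simp
      then show ?thesis
        using cInf_less_iff[OF _ bdd] \<open>x \<in> S\<close> by auto
    qed
    then obtain s where s: "\<And>n. s n \<in> S" "\<And>n. h (s n) < c + 1 / real (Suc n)" by metis
    have lim: "(\<lambda>n. h (s n)) \<longlonglongrightarrow> c"
    proof (rule tendsto_sandwich[of "\<lambda>_. c"])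
      show "(\<lambda>n. c + 1 / real (Suc n)) \<longlonglongrightarrow> c"
        using tendsto_add[OF tendsto_const[of c] LIMSEQ_Suc[OF lim_1_over_n]] by simp
      show "eventually (\<lambda>n. h (s n) \<le> c + 1 / real (Suc n)) sequentially"
        using s(2) by (intro always_eventually allI less_imp_le)
    qed (use c_le s(1) in auto)
    have "compact S" unfolding S_def by simp
    then have "seq_compact S" by (simp add: compact_imp_seq_compact)
    then obtain l r where "strict_mono r" "(s \<circ> r) \<longlonglongrightarrow> l"
      using s(1) by (elim seq_compactE) auto
    then have "P l" unfolding P_def using s(1) LIMSEQ_subseq_LIMSEQ[OF lim, of r]
      by (intro exI[of _ "s \<circ> r"]) (auto simp: o_def)
    then show ?thesis by blast
  qed
  then obtain x0 where "P x0" by blast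
  from escape[of lam P, OF lam this P0 P1] obtain z where z: "P z"
    "(\<forall>i. cos (2 * pi * (lam ^ i * z)) \<noteq> 0) \<or> (cos (2 * pi * z) = 0 \<and> lam * (z + 1/4) = z)"
    by blast
  from z(2) have "1 \<le> c"
  proof
    assume nz: "\<forall>i. cos (2 * pi * (lam ^ i * z)) \<noteq> 0"
    \<comment> \<open>The unblocked descent never leaves \<open>P\<close>, and the lower bounds
      along it tend to 1 because it tends to 0.\<close>
    have "P (lam ^ i * z)" for i
    proof (induction i)
      case (Suc i)
      then show ?case using P0[OF Suc] nz by (simp add: mult.assoc)
    qed (use z(1) in simp)
    then have "1 - C * (lam ^ i * z)\<^sup>2 \<le> c" for i
      using P_bound[of "lam ^ i * z" C 0] near_0 by simp
    moreover have "(\<lambda>i. 1 - C * (lam ^ i * z)\<^sup>2) \<longlonglongrightarrow> 1 - C * (0 * z)\<^sup>2"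
      by (intro tendsto_intros LIMSEQ_realpow_zero) (use lam in auto)
    ultimately show ?thesis
      by (intro LIMSEQ_le_const2[of "\<lambda>i. 1 - C * (lam ^ i * z)\<^sup>2" 1]) auto
  next
    assume "cos (2 * pi * z) = 0 \<and> lam * (z + 1/4) = z"
    then obtain D where "\<And>y. 1 - D * (y - z)\<^sup>2 \<le> h y" using near_fix by blast
    from P_bound[OF z(1) this] show ?thesis by simp
  qed
  then show ?thesis using c_le[OF \<open>x \<in> S\<close>] h_le_1[of x] by simp
qed

subsection \<open>Construction and uniqueness of the path measure\<close>

lemma space_Omega: "space Omega = UNIV \<rightarrow> {0, 1/4}"
  unfolding Omega_def space_PiM by (simp add: PiE_UNIV_domain)

lemma cyl_in_sets [measurable]: "cyl n \<omega> \<in> sets Omega"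
proof -
  have "(\<lambda>\<eta>. \<eta> i) \<in> Omega \<rightarrow>\<^sub>M count_space {0, 1/4}" for i :: nat
    unfolding Omega_def by (rule measurable_component_singleton) simp
  then have "{\<eta> \<in> space Omega. \<eta> i = \<omega> i} \<in> sets Omega" for i :: nat
    by (auto intro!: pred_count_space_const2 simp: pred_def)
  then show ?thesis unfolding cyl_def by measurable
qed

text \<open>The division by \<open>lam\<close> in \<open>W\<close> cancels the contraction, so the
  weight of a move depends only on the state being left and the digit. Digit 1/4 shifts the phase by
  a quarter turn and gives the squared sine.\<close>

lemma W_tau:
  assumes "lam \<noteq> 0"
  shows "W lam (tau lam a z) = (cos (2 * pi * (z + a)))\<^sup>2"
  using assms unfolding W_def tau_def by (simp add: mult.assoc)

text \<open>The measure \<open>P\<^sub>x\<close> is the law of the digits read off from independent uniform variables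
  \<open>u\<close>: in state \<open>y\<close> the digit 0 is chosen iff \<open>u k\<close> is below its probability.\<close>

definition digit :: "real \<Rightarrow> real \<Rightarrow> real" where
  "digit y t = (if t < (cos (2 * pi * y))\<^sup>2 then 0 else 1/4)"

primrec walk :: "real \<Rightarrow> real \<Rightarrow> (nat \<Rightarrow> real) \<Rightarrow> nat \<Rightarrow> real" where
  "walk lam x u 0 = x"
| "walk lam x u (Suc k) = tau lam (digit (walk lam x u k) (u k)) (walk lam x u k)"

definition digits :: "real \<Rightarrow> real \<Rightarrow> (nat \<Rightarrow> real) \<Rightarrow> nat \<Rightarrow> real" where
  "digits lam x u k = digit (walk lam x u k) (u k)"

lemma orb_digits: "orb lam x (digits lam x u) k = walk lam x u k"
  by (induction k) (simp_all add: digits_def)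

lemma orb_cong: "(\<And>i. i < n \<Longrightarrow> \<omega> i = \<eta> i) \<Longrightarrow> orb lam x \<omega> n = orb lam x \<eta> n"
  by (induction n) auto

text \<open>On the right the states come from the fixed word \<omega>, so each condition involves a
  single coordinate of \<open>u\<close>. This decouples the digits and makes the preimage of a
  cylinder a product set.\<close>

lemma digits_eq_iff:
  "(\<forall>i<n. digits lam x u i = \<omega> i) \<longleftrightarrow> (\<forall>i<n. digit (orb lam x \<omega> i) (u i) = \<omega> i)"
proof (induction n)
  case (Suc n)
  show ?case
  proof (cases "\<forall>i<n. digits lam x u i = \<omega> i")
    case True
    then have "walk lam x u n = orb lam x \<omega> n"
      using orb_cong[of n "digits lam x u" \<omega> lam x] by (simp add: orb_digits)
    then have "digits lam x u n = digit (orb lam x \<omega> n) (u n)" by (simp add: digits_def)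
    then show ?thesis using Suc by (auto simp: less_Suc_eq)
  qed (use Suc in \<open>auto simp: less_Suc_eq\<close>)
qed simp

abbreviation unif :: "real measure" where
  "unif \<equiv> uniform_measure lborel {0..1}"

lemma prob_space_unif: "prob_space unif"
  by (rule prob_space_uniform_measure) auto

lemma emeasure_unif_less:
  assumes "0 \<le> p" "p \<le> 1"
  shows "emeasure unif {t. t < p} = ennreal p"
proof -
  have "{0..1} \<inter> {t. t < p} = {0..<p}" using assms by auto
  then show ?thesis using assms by (simp add: divide_ennreal_def)
qed

lemma emeasure_unif_digit:
  assumes "lam \<noteq> 0" "a \<in> {0, 1/4}"
  shows "emeasure unif {t. digit y t = a} = ennreal (W lam (tau lam a y))"
proof -
  interpret prob_space unif by (rule prob_space_unif)
  have p: "0 \<le> (cos (2 * pi * y))\<^sup>2" "(cos (2 * pi * y))\<^sup>2 \<le> 1"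
    by (simp_all add: abs_square_le_1)
  have less: "emeasure unif {t. digit y t = 0} = ennreal ((cos (2 * pi * y))\<^sup>2)"
    using emeasure_unif_less[OF p] by (simp add: digit_def cong: if_cong)
  show ?thesis
  proof (cases "a = 0")
    case True
    then show ?thesis using less assms by (simp add: W_tau)
  next
    case False
    then have "a = 1/4" using assms by simp
    have "{t. digit y t = 1/4} = space unif - {t. digit y t = 0}"
      by (auto simp: digit_def)
    moreover have "{t. digit y t = 0} \<in> sets unif" by (simp add: digit_def)
    ultimately have "emeasure unif {t. digit y t = 1/4} = 1 - ennreal ((cos (2 * pi * y))\<^sup>2)"
      using emeasure_compl[of "{t. digit y t = 0}" unif] unfolding less emeasure_space_1 by simp
    also have "\<dots> = ennreal (1 - (cos (2 * pi * y))\<^sup>2)"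
      using p by (metis ennreal_1 ennreal_minus)
    also have "1 - (cos (2 * pi * y))\<^sup>2 = (cos (2 * pi * (y + 1/4)))\<^sup>2"
    proof -
      have "2 * pi * (y + 1/4) = 2 * pi * y + pi / 2" by (simp add: algebra_simps)
      then show ?thesis by (simp add: cos_add sin_squared_eq)
    qed
    finally show ?thesis unfolding \<open>a = 1/4\<close> W_tau[OF assms(1)] .
  qed
qed

lemma walk_measurable [measurable]:
  "(\<lambda>u. walk lam x u k) \<in> borel_measurable (PiM UNIV (\<lambda>_. unif))"
proof (induction k)
  case (Suc k)
  note [measurable] = Suc
  have [measurable]: "(\<lambda>u. u k) \<in> borel_measurable (PiM UNIV (\<lambda>_. unif))"
    using measurable_component_singleton[of k UNIV "\<lambda>_. unif"]
    by (simp cong: measurable_cong_sets)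
  show ?case by (simp add: tau_def digit_def)
qed simp

lemma digits_measurable:
  "digits lam x \<in> PiM UNIV (\<lambda>_. unif) \<rightarrow>\<^sub>M Omega"
proof -
  have "(\<lambda>u k. digits lam x u k) \<in> PiM UNIV (\<lambda>_. unif) \<rightarrow>\<^sub>M Omega"
    unfolding Omega_def
  proof (rule measurable_PiM_single')
    fix k :: nat
    have [measurable]: "(\<lambda>u. u k) \<in> borel_measurable (PiM UNIV (\<lambda>_. unif))"
      using measurable_component_singleton[of k UNIV "\<lambda>_. unif"]
      by (simp cong: measurable_cong_sets)
    have "(\<lambda>u. digits lam x u k) \<in> borel_measurable (PiM UNIV (\<lambda>_. unif))"
      unfolding digits_def digit_def by measurable
    then show "(\<lambda>u. digits lam x u k) \<in> PiM UNIV (\<lambda>_. unif) \<rightarrow>\<^sub>M count_space {0, 1/4}"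
      by (auto simp: measurable_count_space_eq2 digits_def digit_def intro: measurable_sets)
  qed (auto simp: digits_def digit_def)
  then show ?thesis by simp
qed

text \<open>The predicate under the definite description in \<open>Px\<close>, isolated so that
  existence and uniqueness can be proved for it.\<close>

definition is_Px :: "real \<Rightarrow> real \<Rightarrow> (nat \<Rightarrow> real) measure \<Rightarrow> bool" where
  "is_Px lam x M \<longleftrightarrow> sets M = sets Omega \<and> prob_space M \<and>
      (\<forall>n \<omega>. (\<forall>i<n. \<omega> i \<in> {0, 1/4}) \<longrightarrow>
         emeasure M (cyl n \<omega>) = ennreal (\<Prod>i<n. W lam (orb lam x \<omega> (Suc i))))"

text \<open>By \<open>digits_eq_iff\<close> the preimage of a cylinder is a finite-dimensional box,
  and the product measure of that box is the product of the one-digit probabilities.\<close>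

lemma is_Px_exists:
  assumes "lam \<noteq> 0"
  shows "is_Px lam x (distr (PiM UNIV (\<lambda>_. unif)) Omega (digits lam x))"
proof -
  interpret product_prob_space "\<lambda>_. unif" UNIV
    by (rule product_prob_spaceI) (rule prob_space_unif)
  let ?U = "PiM UNIV (\<lambda>_::nat. unif)"
  have "emeasure (distr ?U Omega (digits lam x)) (cyl n \<omega>) = ennreal (\<Prod>i<n. W lam (orb lam x \<omega> (Suc i)))"
    if \<omega>: "\<forall>i<n. \<omega> i \<in> {0, 1/4}" for n \<omega>
  proof -
    have mem: "digits lam x u \<in> space Omega" for u
      by (auto simp: space_Omega digits_def digit_def)
    have "emeasure (distr ?U Omega (digits lam x)) (cyl n \<omega>)
        = emeasure ?U (digits lam x -` cyl n \<omega> \<inter> space ?U)"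
      by (rule emeasure_distr[OF digits_measurable cyl_in_sets])
    also have "digits lam x -` cyl n \<omega> \<inter> space ?U =
        {u \<in> space ?U. \<forall>i\<in>{..<n}. u i \<in> {t. digit (orb lam x \<omega> i) t = \<omega> i}}"
      using mem by (auto simp: cyl_def digits_eq_iff)
    also have "emeasure ?U \<dots> = (\<Prod>i\<in>{..<n}. emeasure unif {t. digit (orb lam x \<omega> i) t = \<omega> i})"
      by (rule emeasure_PiM_Collect) (auto simp: digit_def)
    also have "\<dots> = (\<Prod>i\<in>{..<n}. ennreal (W lam (orb lam x \<omega> (Suc i))))"
      using \<omega> emeasure_unif_digit[OF assms] by (intro prod.cong) auto
    also have "\<dots> = ennreal (\<Prod>i<n. W lam (orb lam x \<omega> (Suc i)))"
      by (rule prod_ennreal) (simp add: W_def)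
    finally show ?thesis .
  qed
  then show ?thesis
    unfolding is_Px_def using P.prob_space_distr[OF digits_measurable] by simp
qed

text \<open>Boxes determine a measure on the product space, and each box is a finite disjoint union
  of cylinders of a common length, whose measures are prescribed.\<close>

lemma is_Px_unique:
  assumes M: "is_Px lam x M" and M': "is_Px lam x M'"
  shows "M = M'"
proof (rule measure_eqI_PiM_infinite)
  show "sets M = sets (PiM UNIV (\<lambda>_. count_space {0, 1/4}))"
    "sets M' = sets (PiM UNIV (\<lambda>_. count_space {0, 1/4}))"
    using M M' unfolding is_Px_def Omega_def by auto
  interpret M: prob_space M using M unfolding is_Px_def by auto
  show "finite_measure M" by unfold_locales
  fix A :: "nat \<Rightarrow> real set" and J :: "nat set"
  assume J: "finite J" and A: "\<And>i. i \<in> J \<Longrightarrow> A i \<in> sets (count_space {0, 1/4})"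
  obtain n where n: "J \<subseteq> {..<n}" using finite_nat_bounded[OF J] by blast
  \<comment> \<open>Words of length \<open>n\<close>, free outside \<open>J\<close>. As extensional
    functions, distinct words differ at some index below \<open>n\<close>, which makes their
    cylinders disjoint.\<close>
  define F where "F = (\<Pi>\<^sub>E i\<in>{..<n}. if i \<in> J then A i else {0, 1/4})"
  have F_sub: "\<forall>i<n. \<omega> i \<in> {0, 1/4}" if "\<omega> \<in> F" for \<omega>
    using that A unfolding F_def by (fastforce simp: PiE_iff split: if_splits)
  have "finite F"
    unfolding F_def by (rule finite_PiE) (use A in \<open>auto intro: finite_subset[of _ "{0, 1/4}"]\<close>)
  have box: "prod_emb UNIV (\<lambda>_. count_space {0, 1/4}) J (Pi\<^sub>E J A) = (\<Union>\<omega>\<in>F. cyl n \<omega>)"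
  proof (intro set_eqI iffI)
    fix \<eta> assume "\<eta> \<in> prod_emb UNIV (\<lambda>_. count_space {0, 1/4}) J (Pi\<^sub>E J A)"
    then have \<eta>: "\<eta> \<in> space Omega" "\<forall>i\<in>J. \<eta> i \<in> A i"
      by (auto simp: prod_emb_def space_Omega PiE_iff Pi_iff)
    then have "restrict \<eta> {..<n} \<in> F" "\<eta> \<in> cyl n (restrict \<eta> {..<n})"
      by (auto simp: F_def cyl_def space_Omega PiE_iff Pi_iff)
    then show "\<eta> \<in> (\<Union>\<omega>\<in>F. cyl n \<omega>)" by blast
  next
    fix \<eta> assume "\<eta> \<in> (\<Union>\<omega>\<in>F. cyl n \<omega>)"
    then obtain \<omega> where \<omega>: "\<omega> \<in> F" "\<eta> \<in> space Omega" "\<forall>i<n. \<eta> i = \<omega> i"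
      by (auto simp: cyl_def)
    then have "\<eta> i \<in> A i" if "i \<in> J" for i
    proof -
      have "i < n" using n that by auto
      then have "\<omega> i \<in> (if i \<in> J then A i else {0, 1/4})"
        using PiE_mem[OF \<omega>(1)[unfolded F_def], of i] by simp
      then show ?thesis using \<omega>(3) \<open>i < n\<close> that by simp
    qed
    then show "\<eta> \<in> prod_emb UNIV (\<lambda>_. count_space {0, 1/4}) J (Pi\<^sub>E J A)"
      using \<omega>(2) by (auto simp: prod_emb_def space_Omega PiE_iff Pi_iff)
  qed
  have disj: "disjoint_family_on (cyl n) F"
    unfolding disjoint_family_on_def
  proof (intro ballI impI)
    fix \<omega> \<omega>' assume *: "\<omega> \<in> F" "\<omega>' \<in> F" "\<omega> \<noteq> \<omega>'"
    have "\<exists>i\<in>{..<n}. \<omega> i \<noteq> \<omega>' i"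
      using PiE_ext[OF *(1,2)[unfolded F_def]] *(3) by blast
    then obtain i where "i < n" "\<omega> i \<noteq> \<omega>' i" by auto
    then show "cyl n \<omega> \<inter> cyl n \<omega>' = {}" by (auto simp: cyl_def)
  qed
  have "emeasure N (\<Union>\<omega>\<in>F. cyl n \<omega>) = (\<Sum>\<omega>\<in>F. ennreal (\<Prod>i<n. W lam (orb lam x \<omega> (Suc i))))"
    if N: "is_Px lam x N" for N
  proof -
    have "emeasure N (\<Union>\<omega>\<in>F. cyl n \<omega>) = (\<Sum>\<omega>\<in>F. emeasure N (cyl n \<omega>))"
      using N \<open>finite F\<close> disj by (intro sum_emeasure[symmetric]) (auto simp: is_Px_def)
    also have "\<dots> = (\<Sum>\<omega>\<in>F. ennreal (\<Prod>i<n. W lam (orb lam x \<omega> (Suc i))))"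
      using N F_sub by (intro sum.cong) (auto simp: is_Px_def)
    finally show ?thesis .
  qed
  from this[OF M] this[OF M'] show
    "emeasure M (prod_emb UNIV (\<lambda>_. count_space {0, 1/4}) J (Pi\<^sub>E J A)) =
     emeasure M' (prod_emb UNIV (\<lambda>_. count_space {0, 1/4}) J (Pi\<^sub>E J A))"
    unfolding box by simp
qed

lemma is_Px_Px:
  assumes "lam \<noteq> 0"
  shows "is_Px lam x (Px lam x)"
proof -
  have "Px lam x = (THE M. is_Px lam x M)" unfolding Px_def is_Px_def ..
  moreover have "\<exists>!M. is_Px lam x M"
    using is_Px_exists[OF assms] is_Px_unique by blast
  ultimately show ?thesis using theI'[of "is_Px lam x"] by simp
qed

subsection \<open>Countable shift-invariant events\<close>

lemma singleton_eq_INT_cyl: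
  assumes "\<omega> \<in> space Omega"
  shows "{\<omega>} = (\<Inter>n. cyl n \<omega>)"
  using assms by (auto simp: cyl_def)

lemma singleton_in_sets:
  assumes "\<omega> \<in> space Omega"
  shows "{\<omega>} \<in> sets Omega"
  unfolding singleton_eq_INT_cyl[OF assms] by (intro sets.countable_INT) auto

text \<open>The cylinders around a path decrease to it, so its mass is the infinite product of its
  step probabilities.\<close>

lemma tendsto_measure_Px_singleton:
  assumes "lam \<noteq> 0" "\<omega> \<in> space Omega"
  shows "(\<lambda>n. \<Prod>i<n. W lam (orb lam x \<omega> (Suc i))) \<longlonglongrightarrow> measure (Px lam x) {\<omega>}"
proof -
  note Px = is_Px_Px[OF assms(1), of x]
  interpret prob_space "Px lam x" using Px unfolding is_Px_def by simp
  have "\<forall>i<n. \<omega> i \<in> {0, 1/4}" for n using assms(2) by (auto simp: space_Omega Pi_iff)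
  then have "emeasure (Px lam x) (cyl n \<omega>) = ennreal (\<Prod>i<n. W lam (orb lam x \<omega> (Suc i)))" for n
    using Px unfolding is_Px_def by blast
  then have eq: "measure (Px lam x) (cyl n \<omega>) = (\<Prod>i<n. W lam (orb lam x \<omega> (Suc i)))" for n
    unfolding measure_def by (simp add: prod_nonneg W_def)
  have "(\<lambda>n. measure (Px lam x) (cyl n \<omega>)) \<longlonglongrightarrow> measure (Px lam x) (\<Inter>n. cyl n \<omega>)"
    by (rule finite_Lim_measure_decseq)
      (use Px in \<open>auto simp: is_Px_def decseq_def cyl_def[abs_def] intro: cyl_in_sets[unfolded cyl_def]\<close>)
  then show ?thesis by (simp add: eq singleton_eq_INT_cyl[OF assms(2)])
qed

lemma orb_case_nat: "orb lam x (case_nat a \<omega>) (Suc i) = orb lam (tau lam a x) \<omega> i"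
  by (induction i) auto

text \<open>A prepended digit contributes the first factor of the infinite product and moves the
  starting point. This is the Markov property for a single path.\<close>

lemma measure_Px_singleton_case_nat:
  assumes "lam \<noteq> 0" "\<omega> \<in> space Omega" "a \<in> {0, 1/4}"
  shows "measure (Px lam x) {case_nat a \<omega>} = W lam (tau lam a x) * measure (Px lam (tau lam a x)) {\<omega>}"
proof -
  have "case_nat a \<omega> \<in> space Omega"
    using assms by (auto simp: space_Omega Pi_iff split: nat.split)
  from tendsto_measure_Px_singleton[OF assms(1) this, THEN LIMSEQ_Suc]
  have "(\<lambda>n. W lam (tau lam a x) * (\<Prod>i<n. W lam (orb lam (tau lam a x) \<omega> (Suc i))))
      \<longlonglongrightarrow> measure (Px lam x) {case_nat a \<omega>}"
    by (simp only: prod.lessThan_Suc_shift orb_case_nat orb.simps(1))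
  moreover have "(\<lambda>n. W lam (tau lam a x) * (\<Prod>i<n. W lam (orb lam (tau lam a x) \<omega> (Suc i))))
      \<longlonglongrightarrow> W lam (tau lam a x) * measure (Px lam (tau lam a x)) {\<omega>}"
    by (intro tendsto_mult_left tendsto_measure_Px_singleton assms)
  ultimately show ?thesis by (rule LIMSEQ_unique)
qed

text \<open>Countability reduces the claim to singletons: summing the one-path identity over
  \<open>N\<close> gives the first-step decomposition.\<close>

lemma measure_Px_harmonic:
  assumes lam: "lam \<noteq> 0" and N: "countable N" "N \<subseteq> space Omega"
    and shift: "\<And>a \<omega>. a \<in> {0, 1/4} \<Longrightarrow> \<omega> \<in> space Omega \<Longrightarrow> case_nat a \<omega> \<in> N \<longleftrightarrow> \<omega> \<in> N"
  shows "measure (Px lam x) N = (cos (2 * pi * x))\<^sup>2 * measure (Px lam (lam * x)) N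
     + (sin (2 * pi * x))\<^sup>2 * measure (Px lam (lam * (x + 1/4))) N"
proof -
  have sets: "sets (Px lam y) = sets Omega" and prob: "prob_space (Px lam y)" for y
    using is_Px_Px[OF lam, of y] unfolding is_Px_def by auto
  have sing: "{\<omega>} \<in> sets (Px lam y)" if "\<omega> \<in> N" for y \<omega>
    using that N(2) singleton_in_sets sets by auto
  have N_sets: "N' \<in> sets (Px lam y)" if "N' \<subseteq> N" for y N'
    by (rule sets.countable) (use sing that countable_subset[OF that N(1)] in auto)
  have sub: "case_nat a ` N \<subseteq> N" if "a \<in> {0, 1/4}" for a
    using that shift N(2) by blast
  have piece: "measure (Px lam x) (case_nat a ` N) = W lam (tau lam a x) * measure (Px lam (tau lam a x)) N"
    if a: "a \<in> {0, 1/4}" for a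
  proof -
    interpret prob_space "Px lam x" by (rule prob)
    interpret Q: prob_space "Px lam (tau lam a x)" by (rule prob)
    have inj: "inj_on (case_nat a) N"
      by (auto simp: inj_on_def fun_eq_iff split: nat.splits)
    have "emeasure (Px lam x) (case_nat a ` N)
        = (\<integral>\<^sup>+\<omega>. emeasure (Px lam x) {\<omega>} \<partial>count_space (case_nat a ` N))"
      by (rule emeasure_countable_singleton) (use sub[OF a] sing N(1) in auto)
    also have "\<dots> = (\<integral>\<^sup>+\<omega>. emeasure (Px lam x) {case_nat a \<omega>} \<partial>count_space N)"
      by (rule nn_integral_bij_count_space[symmetric]) (use inj in \<open>auto simp: bij_betw_def\<close>)
    also have "\<dots> = (\<integral>\<^sup>+\<omega>. ennreal (W lam (tau lam a x)) * emeasure (Px lam (tau lam a x)) {\<omega>} \<partial>count_space N)"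
    proof (rule nn_integral_cong)
      fix \<omega> assume "\<omega> \<in> space (count_space N)"
      then have "\<omega> \<in> space Omega" using N(2) by auto
      from measure_Px_singleton_case_nat[OF lam this a, of x]
      show "emeasure (Px lam x) {case_nat a \<omega>} =
          ennreal (W lam (tau lam a x)) * emeasure (Px lam (tau lam a x)) {\<omega>}"
        by (simp add: emeasure_eq_measure Q.emeasure_eq_measure ennreal_mult W_def)
    qed
    also have "\<dots> = ennreal (W lam (tau lam a x)) * (\<integral>\<^sup>+\<omega>. emeasure (Px lam (tau lam a x)) {\<omega>} \<partial>count_space N)"
      by (rule nn_integral_cmult) simp
    also have "(\<integral>\<^sup>+\<omega>. emeasure (Px lam (tau lam a x)) {\<omega>} \<partial>count_space N) = emeasure (Px lam (tau lam a x)) N"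
      by (rule emeasure_countable_singleton[symmetric]) (use sing N(1) in auto)
    finally show ?thesis
      by (simp add: emeasure_eq_measure Q.emeasure_eq_measure W_def flip: ennreal_mult)
  qed
  \<comment> \<open>Shift invariance lets the first digit be stripped, so \<open>N\<close> splits
    into two disjoint copies of itself.\<close>
  have "N = case_nat 0 ` N \<union> case_nat (1/4) ` N"
  proof
    show "N \<subseteq> case_nat 0 ` N \<union> case_nat (1/4) ` N"
    proof
      fix \<omega> assume \<omega>: "\<omega> \<in> N"
      define \<eta> where "\<eta> = (\<lambda>n. \<omega> (Suc n))"
      have eq: "\<omega> = case_nat (\<omega> 0) \<eta>" by (auto simp: \<eta>_def fun_eq_iff split: nat.split)
      have "\<omega> \<in> space Omega" using \<omega> N(2) by auto
      then have a: "\<omega> 0 \<in> {0, 1/4}" "\<eta> \<in> space Omega"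
        by (auto simp: space_Omega Pi_iff \<eta>_def)
      then have "\<eta> \<in> N" using shift[OF a] \<omega> eq by simp
      with eq have "\<omega> \<in> case_nat (\<omega> 0) ` N" by (rule image_eqI)
      moreover have "\<omega> 0 = 0 \<or> \<omega> 0 = 1/4" using a(1) by simp
      ultimately show "\<omega> \<in> case_nat 0 ` N \<union> case_nat (1/4) ` N"
        by (elim disjE) auto
    qed
  qed (use sub in auto)
  moreover have "case_nat 0 ` N \<inter> case_nat (1/4) ` N = {}"
    by (auto simp: fun_eq_iff dest!: spec[of _ 0])
  ultimately have "measure (Px lam x) N
      = measure (Px lam x) (case_nat 0 ` N) + measure (Px lam x) (case_nat (1/4) ` N)"
    using finite_measure.finite_measure_Union[OF prob_space.finite_measure[OF prob],
        of "case_nat 0 ` N" x "case_nat (1/4) ` N"] sub N_sets by simp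
  moreover have "(cos (2 * pi * (x + 1/4)))\<^sup>2 = (sin (2 * pi * x))\<^sup>2"
  proof -
    have "2 * pi * (x + 1/4) = 2 * pi * x + pi / 2" by (simp add: algebra_simps)
    then show ?thesis by (simp add: cos_add)
  qed
  ultimately show ?thesis using lam by (simp add: piece W_tau) (simp add: tau_def)
qed

section \<open>Mass of constant paths near fixed points\<close>

text \<open>At \<open>t\<close> the digit \<open>a\<close> is certain and the state stays at
  \<open>t\<close>. From \<open>x\<close> the constant path approaches \<open>t\<close> like
  \<open>lam ^ i\<close>, so the failure probabilities are dominated by a geometric series, whose
  sum gives the constant. The Weierstrass inequality bounds the product of the success probabilities
  below by 1 minus that sum.\<close>

lemma measure_Px_const_ge:
  assumes lam: "0 < lam" "lam < 1" and a: "a \<in> {0, 1/4}"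
    and t: "lam * (t + a) = t" "sin (2 * pi * (t + a)) = 0"
  shows "1 - (4 * pi\<^sup>2 / (1 - lam\<^sup>2)) * (x - t)\<^sup>2 \<le> measure (Px lam x) {\<lambda>_. a}"
proof -
  have orb: "orb lam x (\<lambda>_. a) i = t + lam ^ i * (x - t)" for i
  proof (induction i)
    case (Suc i)
    have "orb lam x (\<lambda>_. a) (Suc i) = lam * (t + a) + lam * (lam ^ i * (x - t))"
      by (simp add: Suc tau_def algebra_simps)
    then show ?case using t(1) by simp
  qed simp
  have sin_le: "(sin (2 * pi * (t + lam ^ i * (x - t) + a)))\<^sup>2 \<le> 4 * pi\<^sup>2 * (x - t)\<^sup>2 * (lam\<^sup>2) ^ i" for i
  proof -
    \<comment> \<open>The phase offset from the fixed point. As the sine vanishes there, only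
      \<open>sin B\<close> survives, and its modulus is at most that of \<open>B\<close>.\<close>
    define B where "B = 2 * pi * (lam ^ i * (x - t))"
    have "2 * pi * (t + lam ^ i * (x - t) + a) = 2 * pi * (t + a) + B"
      by (simp add: B_def algebra_simps)
    then have "(sin (2 * pi * (t + lam ^ i * (x - t) + a)))\<^sup>2 = (cos (2 * pi * (t + a)))\<^sup>2 * (sin B)\<^sup>2"
      using t(2) by (simp add: sin_add power_mult_distrib)
    also have "\<dots> \<le> 1 * B\<^sup>2"
      by (intro mult_mono) (auto simp: abs_square_le_1 abs_le_square_iff[symmetric] abs_sin_x_le_abs_x)
    also have "\<dots> = 4 * pi\<^sup>2 * (x - t)\<^sup>2 * (lam\<^sup>2) ^ i"
      by (simp add: B_def power_mult_distrib power_mult[symmetric] mult.commute)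
    finally show ?thesis .
  qed
  have lam2: "lam\<^sup>2 < 1" using lam by (simp add: power_less_one_iff)
  have "1 - (4 * pi\<^sup>2 / (1 - lam\<^sup>2)) * (x - t)\<^sup>2 \<le> (\<Prod>i<n. W lam (orb lam x (\<lambda>_. a) (Suc i)))" for n
  proof -
    have "(\<Sum>i<n. (lam\<^sup>2) ^ i) \<le> 1 / (1 - lam\<^sup>2)"
      using lam2 lam by (simp add: sum_gp_strict divide_right_mono)
    then have "(4 * pi\<^sup>2 * (x - t)\<^sup>2) * (\<Sum>i<n. (lam\<^sup>2) ^ i) \<le> (4 * pi\<^sup>2 * (x - t)\<^sup>2) * (1 / (1 - lam\<^sup>2))"
      by (intro mult_left_mono) auto
    moreover have "(\<Sum>i<n. (sin (2 * pi * (t + lam ^ i * (x - t) + a)))\<^sup>2)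
        \<le> (4 * pi\<^sup>2 * (x - t)\<^sup>2) * (\<Sum>i<n. (lam\<^sup>2) ^ i)"
      unfolding sum_distrib_left by (intro sum_mono sin_le)
    moreover have "1 - (\<Sum>i<n. (sin (2 * pi * (t + lam ^ i * (x - t) + a)))\<^sup>2)
        \<le> (\<Prod>i<n. 1 - (sin (2 * pi * (t + lam ^ i * (x - t) + a)))\<^sup>2)"
      by (rule Weierstrass_prod_ineq) (auto simp: abs_square_le_1)
    moreover have "(\<Prod>i<n. 1 - (sin (2 * pi * (t + lam ^ i * (x - t) + a)))\<^sup>2)
        = (\<Prod>i<n. W lam (orb lam x (\<lambda>_. a) (Suc i)))"
      using lam by (intro prod.cong) (auto simp: orb W_tau cos_squared_eq simp del: orb.simps(1))
    ultimately show ?thesis by simp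
  qed
  moreover have "(\<lambda>n. \<Prod>i<n. W lam (orb lam x (\<lambda>_. a) (Suc i))) \<longlonglongrightarrow> measure (Px lam x) {\<lambda>_. a}"
    by (rule tendsto_measure_Px_singleton) (use lam a in \<open>auto simp: space_Omega\<close>)
  ultimately show ?thesis by (intro LIMSEQ_le_const) auto
qed

section \<open>Eventually constant sequences and the conclusion\<close>

definition eventually_const :: "real \<Rightarrow> (nat \<Rightarrow> real) set" where
  "eventually_const a = {\<omega> \<in> space Omega. \<exists>N. \<forall>n\<ge>N. \<omega> n = a}"

lemma N0_eq_eventually_const: "N0 = eventually_const 0" and N1_eq_eventually_const: "N1 = eventually_const (1/4)"
  unfolding N0_def N1_def eventually_const_def by simp_all

text \<open>A member is determined by some \<open>N\<close> and its first \<open>N\<close> digits,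
  and finite words are countable. This opens the way to \<open>measure_Px_harmonic\<close>.\<close>

lemma countable_eventually_const: "countable (eventually_const a)"
proof -
  have "eventually_const a \<subseteq> (\<Union>N. (\<lambda>l n. if n < N then l ! n else a) ` {l. set l \<subseteq> {0, 1/4} \<and> length l = N})"
  proof
    fix \<omega> assume "\<omega> \<in> eventually_const a"
    then obtain N where N: "\<omega> \<in> space Omega" "\<forall>n\<ge>N. \<omega> n = a" unfolding eventually_const_def by blast
    then have "\<omega> = (\<lambda>n. if n < N then map \<omega> [0..<N] ! n else a)" by auto
    moreover have "map \<omega> [0..<N] \<in> {l. set l \<subseteq> {0, 1/4} \<and> length l = N}"
      using N(1) by (auto simp: space_Omega Pi_iff)
    ultimately show "\<omega> \<in> (\<Union>N. (\<lambda>l n. if n < N then l ! n else a) ` {l. set l \<subseteq> {0, 1/4} \<and> length l = N})"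
      by blast
  qed
  moreover have "countable (\<Union>N. (\<lambda>l n. if n < N then l ! n else a) ` {l. set l \<subseteq> {0, 1/4} \<and> length l = N})"
    by (intro countable_UN countable_image countable_finite[OF finite_lists_length_eq]) auto
  ultimately show ?thesis by (rule countable_subset)
qed

lemma case_nat_in_eventually_const_iff:
  assumes "b \<in> {0, 1/4}" "\<omega> \<in> space Omega"
  shows "case_nat b \<omega> \<in> eventually_const a \<longleftrightarrow> \<omega> \<in> eventually_const a"
proof -
  have "(\<exists>N. \<forall>n\<ge>N. case_nat b \<omega> n = a) \<longleftrightarrow> (\<exists>N. \<forall>n\<ge>N. \<omega> n = a)"
  proof
    assume "\<exists>N. \<forall>n\<ge>N. case_nat b \<omega> n = a"
    then obtain N where N: "\<forall>n\<ge>N. case_nat b \<omega> n = a" by blast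
    have "\<omega> n = a" if "n \<ge> N" for n using spec[OF N, of "Suc n"] that by simp
    then show "\<exists>N. \<forall>n\<ge>N. \<omega> n = a" by blast
  next
    assume "\<exists>N. \<forall>n\<ge>N. \<omega> n = a"
    then obtain N where N: "\<forall>n\<ge>N. \<omega> n = a" by blast
    then have "\<forall>n\<ge>Suc N. case_nat b \<omega> n = a" by (auto split: nat.split)
    then show "\<exists>N. \<forall>n\<ge>N. case_nat b \<omega> n = a" by blast
  qed
  then show ?thesis using assms unfolding eventually_const_def space_Omega
    by (auto simp: Pi_iff split: nat.splits)
qed

text \<open>The constant paths in \<open>N\<close> supply the boundary bounds for
  \<open>harmonic_eq_1\<close>. \<open>quarter\<close> is conditional so that both parts of the
  theorem are covered: for \<open>N0\<close> its premises must be unsatisfiable, for the union with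
  \<open>N1\<close> its conclusion always holds.\<close>

lemma measure_Px_eq_1:
  assumes lam: "0 < lam" "lam < 1" and N: "countable N" "N \<subseteq> space Omega"
    and shift: "\<And>a \<omega>. a \<in> {0, 1/4} \<Longrightarrow> \<omega> \<in> space Omega \<Longrightarrow> case_nat a \<omega> \<in> N \<longleftrightarrow> \<omega> \<in> N"
    and zero: "(\<lambda>_. 0) \<in> N"
    and quarter: "\<And>z. cos (2 * pi * z) = 0 \<Longrightarrow> lam * (z + 1/4) = z \<Longrightarrow> (\<lambda>_. 1/4) \<in> N"
  shows "measure (Px lam x) N = 1"
proof -
  have sets: "sets (Px lam y) = sets Omega" and prob: "prob_space (Px lam y)" for y
    using is_Px_Px[of lam y] lam unfolding is_Px_def by auto
  have "N \<in> sets (Px lam y)" for y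
    by (rule sets.countable) (use N singleton_in_sets sets in auto)
  then have mono: "measure (Px lam y) {\<omega>} \<le> measure (Px lam y) N" if "\<omega> \<in> N" for y \<omega>
    using that finite_measure.finite_measure_mono[OF prob_space.finite_measure[OF prob]] by simp
  show ?thesis
  proof (rule harmonic_eq_1[OF lam, where h = "\<lambda>y. measure (Px lam y) N"])
    show "measure (Px lam y) N \<le> 1" for y using prob_space.prob_le_1[OF prob] .
    show "measure (Px lam y) N = (cos (2 * pi * y))\<^sup>2 * measure (Px lam (lam * y)) N
       + (sin (2 * pi * y))\<^sup>2 * measure (Px lam (lam * (y + 1/4))) N" for y
      by (rule measure_Px_harmonic) (use lam N shift in auto)
    show "1 - (4 * pi\<^sup>2 / (1 - lam\<^sup>2)) * y\<^sup>2 \<le> measure (Px lam y) N" for y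
      using measure_Px_const_ge[OF lam, of 0 0 y] mono[OF zero, of y] by simp
    fix z assume z: "cos (2 * pi * z) = 0" "lam * (z + 1/4) = z"
    have "2 * pi * (z + 1/4) = 2 * pi * z + pi / 2" by (simp add: algebra_simps)
    then have "sin (2 * pi * (z + 1/4)) = 0" using z(1) by (simp add: sin_add)
    from measure_Px_const_ge[OF lam _ z(2) this]
    have "1 - (4 * pi\<^sup>2 / (1 - lam\<^sup>2)) * (y - z)\<^sup>2 \<le> measure (Px lam y) {\<lambda>_. 1/4}" for y
      by simp
    then show "\<exists>D. \<forall>y. 1 - D * (y - z)\<^sup>2 \<le> measure (Px lam y) N"
      using mono[OF quarter[OF z]] order_trans by blast
  qed simp
qed

text \<open>Such a \<open>z\<close> is \<open>k / 4\<close> with \<open>k\<close> odd, and the fixed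
  point equation reads \<open>lam = k / (k + 1)\<close>, whence \<open>n = (k + 1) / 2\<close>.
  Negative \<open>k\<close> is excluded because then
  \<open>lam * (k + 1) \<ge> k + 1 > k\<close>.\<close>

lemma quarter_fixed_point_imp_lam:
  assumes lam: "0 < lam" "lam < 1" and z: "cos (2 * pi * z) = 0" "lam * (z + 1/4) = z"
  shows "lam \<in> {1 - 1 / (2 * real n) | n. n \<ge> 1}"
proof -
  obtain k :: int where k: "odd k" "4 * z = of_int k"
    using z(1) by (auto simp: cos_two_pi_eq_0_iff)
  have eq: "lam * (of_int k + 1) = of_int k" using z(2) k(2) by (simp add: field_simps)
  have "0 < k"
  proof (rule ccontr)
    assume "\<not> 0 < k"
    moreover have "k \<noteq> 0" using k(1) by auto
    ultimately have "real_of_int k + 1 \<le> 0" by linarith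
    then have "lam * (of_int k + 1) \<ge> 1 * (real_of_int k + 1)"
      using lam by (intro mult_right_mono_neg) auto
    then show False using eq by simp
  qed
  define n where "n = nat ((k + 1) div 2)"
  have "2 * int n = k + 1" using \<open>0 < k\<close> k(1) even_two_times_div_two[of "k + 1"] unfolding n_def by simp
  then have n: "2 * real n = of_int k + 1" by (metis of_int_1 of_int_add of_int_mult of_int_numeral of_int_of_nat_eq)
  then have "lam = 1 - 1 / (2 * real n)" using eq \<open>0 < k\<close> unfolding n by (simp add: field_simps)
  moreover have "n \<ge> 1" using \<open>0 < k\<close> \<open>2 * int n = k + 1\<close> by linarith
  ultimately show ?thesis by blast
qed

theorem theorem4p6:
  fixes lam :: real
  assumes "0 < lam" and "lam < 1"
  shows "(lam \<notin> {1 - 1 / (2 * real n) | n. n \<ge> 1} \<longrightarrow> (\<forall>x\<in>XL lam. h0 lam x = 1))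
       \<and> (lam \<in> {1 - 1 / (2 * real n) | n. n \<ge> 1} \<longrightarrow> (\<forall>x\<in>XL lam. h0 lam x + h1 lam x = 1))"
proof (intro conjI impI ballI)
  fix x assume "lam \<notin> {1 - 1 / (2 * real n) | n. n \<ge> 1}"
  \<comment> \<open>Outside the exceptional values of \<open>lam\<close> no second absorbing point
    exists, so \<open>quarter\<close> holds vacuously and \<open>N0\<close> alone has full
    measure.\<close>
  then show "h0 lam x = 1"
    unfolding h0_def N0_eq_eventually_const using quarter_fixed_point_imp_lam[OF assms]
    by (intro measure_Px_eq_1[OF assms] countable_eventually_const case_nat_in_eventually_const_iff)
      (auto simp: eventually_const_def space_Omega)
next
  fix x
  have sets: "sets (Px lam x) = sets Omega" and prob: "prob_space (Px lam x)"
    using is_Px_Px[of lam x] assms unfolding is_Px_def by auto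
  interpret prob_space "Px lam x" by (rule prob)
  have "eventually_const a \<in> sets (Px lam x)" for a
    by (rule sets.countable) (use countable_eventually_const singleton_in_sets sets in \<open>auto simp: eventually_const_def\<close>)
  moreover have "eventually_const 0 \<inter> eventually_const (1/4) = {}"
  proof -
    have False if "\<forall>n\<ge>N. \<omega> n = 0" "\<forall>n\<ge>M. \<omega> n = 1/4" for \<omega> :: "nat \<Rightarrow> real" and N M
      using that(1)[rule_format, of "max N M"] that(2)[rule_format, of "max N M"] by simp
    then show ?thesis unfolding eventually_const_def by blast
  qed
  ultimately have "h0 lam x + h1 lam x = measure (Px lam x) (eventually_const 0 \<union> eventually_const (1/4))"
    unfolding h0_def h1_def N0_eq_eventually_const N1_eq_eventually_const by (simp add: finite_measure_Union)
  also have "\<dots> = 1"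
  proof (rule measure_Px_eq_1[OF assms])
    show "case_nat a \<omega> \<in> eventually_const 0 \<union> eventually_const (1/4) \<longleftrightarrow> \<omega> \<in> eventually_const 0 \<union> eventually_const (1/4)"
      if "a \<in> {0, 1/4}" "\<omega> \<in> space Omega" for a \<omega>
      using case_nat_in_eventually_const_iff[OF that] by simp
    show "countable (eventually_const 0 \<union> eventually_const (1/4))" by (simp add: countable_eventually_const)
    have const: "(\<lambda>_. a) \<in> eventually_const a" if "a \<in> {0, 1/4}" for a
      using that by (simp add: eventually_const_def space_Omega)
    show "(\<lambda>_. 0) \<in> eventually_const 0 \<union> eventually_const (1/4)" "(\<lambda>_. 1/4) \<in> eventually_const 0 \<union> eventually_const (1/4)"
      using const by simp_all
  qed (auto simp: eventually_const_def)
  finally show "h0 lam x + h1 lam x = 1" .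
qed

end
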